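(* Let $G$ be a graph with $n$ vertices and let $k\geq 1$ be an integer with $n\geq k+1$. Then $$\chi(F_k(G))\geq \frac{n-k+2}{n}\,\chi(G)-1.$$
   Context: Graphs are finite, simple and undirected. For a graph $G$ and an integer $k\geq 1$, the $k$-token graph $F_k(G)$ is the graph whose vertices are the $k$-element subsets of $V(G)$, where two vertices $A,B$ are adjacent whenever their symmetric difference $A\triangle B$ is a pair $\{a,b\}$ with $a\in A$, $b\in B$ and $ab\in E(G)$. $\chi$ denotes the chromatic number. *)

theory Defs
  imports Complex_Main "HOL-Library.FuncSet" "Graph_Theory.Pair_Digraph"
begin

text \<open>
  A finite simple undirected graph is represented by the locale \<open>pair_graph\<close>:
  finite vertex set, symmetric and irreflexive arc relation. An edge \<open>ab\<close> corresponds to the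
  two arcs \<open>(a, b)\<close> and \<open>(b, a)\<close>.
\<close>

definition token_graph :: "nat \<Rightarrow> 'a pair_pre_digraph \<Rightarrow> 'a set pair_pre_digraph" where
  "token_graph k G =
    (let V = {A. A \<subseteq> pverts G \<and> card A = k} in
     \<lparr> pverts = V,
       parcs = {(A, B). A \<in> V \<and> B \<in> V \<and>
         (\<exists>a\<in>A. \<exists>b\<in>B. sym_diff A B = {a, b} \<and> (a, b) \<in> parcs G)} \<rparr>)"

definition proper_coloring :: "'a pair_pre_digraph \<Rightarrow> nat \<Rightarrow> ('a \<Rightarrow> nat) \<Rightarrow> bool" where
  "proper_coloring G c f \<longleftrightarrow>
    f \<in> pverts G \<rightarrow> {..<c} \<and> (\<forall>(u, v)\<in>parcs G. f u \<noteq> f v)"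

definition chromatic_number :: "'a pair_pre_digraph \<Rightarrow> nat" where
  "chromatic_number G = (LEAST c. \<exists>f. proper_coloring G c f)"

lemma token_graph_simps:
  "pverts (token_graph k G) = {A. A \<subseteq> pverts G \<and> card A = k}"
  "(A, B) \<in> parcs (token_graph k G) \<longleftrightarrow>
    A \<subseteq> pverts G \<and> card A = k \<and> B \<subseteq> pverts G \<and> card B = k \<and>
    (\<exists>a\<in>A. \<exists>b\<in>B. sym_diff A B = {a, b} \<and> (a, b) \<in> parcs G)"
  by (simp_all add: token_graph_def Let_def)

lemma pair_graph_token_graph:
  assumes "pair_graph G"
  shows "pair_graph (token_graph k G)"
proof -
  interpret pair_graph G by (rule assms)
  have fin: "finite (pverts (token_graph k G))"
    using pair_finite_verts by (simp add: token_graph_simps)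
  have sub: "parcs (token_graph k G) \<subseteq> pverts (token_graph k G) \<times> pverts (token_graph k G)"
    unfolding subset_iff split_paired_All mem_Sigma_iff token_graph_simps by blast
  have flip: "(b, a) \<in> parcs G" if "(a, b) \<in> parcs G" for a b
    using pair_sym_arcs that by (simp add: symmetric_def sym_def)
  have irr: "A \<noteq> B" if "(A, B) \<in> parcs (token_graph k G)" for A B
  proof
    assume "A = B"
    with that obtain a b where "sym_diff A A = {a, b}"
      unfolding token_graph_simps by blast
    then show False by blast
  qed
  have sym: "sym (parcs (token_graph k G))"
  proof (rule symI)
    fix A B
    assume "(A, B) \<in> parcs (token_graph k G)"
    then obtain a b where *: "A \<subseteq> pverts G" "card A = k" "B \<subseteq> pverts G" "card B = k"
      "a \<in> A" "b \<in> B" "sym_diff A B = {a, b}" "(a, b) \<in> parcs G"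
      unfolding token_graph_simps by blast
    have "sym_diff B A = {b, a}"
      using *(7) by (metis Un_commute insert_commute)
    with * flip[OF *(8)] show "(B, A) \<in> parcs (token_graph k G)"
      unfolding token_graph_simps by blast
  qed
  have ends: "fst e \<in> pverts (token_graph k G)" "snd e \<in> pverts (token_graph k G)"
    if "e \<in> parcs (token_graph k G)" for e
    using subsetD[OF sub that] by (simp_all only: mem_Times_iff)
  have fin_arcs: "finite (parcs (token_graph k G))"
    by (rule finite_subset[OF sub finite_SigmaI[OF fin fin]])
  have no_loops: "fst e \<noteq> snd e" if "e \<in> parcs (token_graph k G)" for e
    using irr[of "fst e" "snd e"] that by simp
  have sym_arcs: "symmetric (token_graph k G)"
    using sym by (simp add: symmetric_def)
  show ?thesis
    by unfold_locales (fact ends fin fin_arcs no_loops sym_arcs)+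
qed

lemma chromatic_number_attained:
  assumes "pair_graph G"
  shows "\<exists>f. proper_coloring G (chromatic_number G) f"
proof -
  interpret pair_graph G by (rule assms)
  obtain f where f: "bij_betw f (pverts G) {..<card (pverts G)}"
    using ex_bij_betw_finite_nat[OF pair_finite_verts] by (auto simp: lessThan_atLeast0)
  have "f u \<noteq> f v" if "(u, v) \<in> parcs G" for u v
    using f that pair_no_loops[OF that] in_arcsD1[OF that] in_arcsD2[OF that]
    by (auto simp: bij_betw_def inj_on_def)
  then have "proper_coloring G (card (pverts G)) f"
    using f by (auto simp: proper_coloring_def bij_betw_def)
  then have "\<exists>f. proper_coloring G (card (pverts G)) f"
    by (rule exI[of _ f])
  then show ?thesis
    unfolding chromatic_number_def by (rule LeastI[where P = "\<lambda>c. \<exists>f. proper_coloring G c f"])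
qed

end

theory Submission
  imports Defs
begin

text \<open>
  Let \<open>c\<close> and \<open>d\<close> be the chromatic numbers of \<open>G\<close> and of its token graph. Placing \<open>k - 1\<close> tokens
  on a fixed set \<open>S\<close> and moving the last one embeds \<open>G - S\<close> into the token graph. A union of \<open>j\<close>
  classes of an optimal colouring of \<open>G\<close> cannot be coloured with fewer than \<open>j\<close> colours; hence any
  \<open>d + 1\<close> classes cover at least \<open>n - k + 2\<close> vertices, as otherwise their complement would have
  room for \<open>S\<close>. Some \<open>d + 1\<close> classes cover at most \<open>(d + 1) n / c\<close> vertices, by averaging.
\<close>

text \<open>Downward induction from \<open>J = C\<close>: discarding a heaviest element never raises
  the average weight. The inequality between averages is stated with denominators cleared, so
  \<open>j = 0\<close> and empty \<open>C\<close> are no exceptions.\<close>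

lemma exists_subset_sum_le_average:
  fixes w :: "'a \<Rightarrow> real"
  assumes "finite C" "j \<le> card C"
  shows "\<exists>J\<subseteq>C. card J = j \<and> real (card C) * sum w J \<le> real j * sum w C"
  using assms(2)
proof (induction j rule: inc_induct)
  case base
  show ?case by auto
next
  case (step j)
  then obtain J where J: "J \<subseteq> C" "card J = Suc j"
    and le: "real (card C) * sum w J \<le> real (Suc j) * sum w C" by blast
  have fin: "finite J" using J(1) assms(1) by (rule finite_subset)
  have ne: "J \<noteq> {}" using J(2) by auto
  obtain x where x: "x \<in> J" and x_max: "\<And>y. y \<in> J \<Longrightarrow> w y \<le> w x"
    using Max_in[of "w ` J"] Max_ge[of "w ` J"] fin ne
    by (metis (no_types, lifting) finite_imageI image_iff image_is_empty)
  have "sum w J \<le> real (Suc j) * w x"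
    using sum_bounded_above[of J w "w x"] x_max J(2) by simp
  \<comment> \<open>Taking \<open>Suc j\<close> times \<open>w x\<close> away from
    \<open>Suc j\<close> times \<open>sum w J\<close> removes at least one whole
    \<open>sum w J\<close>.\<close>
  then have "real (Suc j) * sum w (J - {x}) \<le> real j * sum w J"
    using fin x by (simp add: sum_diff1 algebra_simps)
  then have "real (card C) * (real (Suc j) * sum w (J - {x})) \<le> real (card C) * (real j * sum w J)"
    by (rule mult_left_mono) simp
  also have "\<dots> = real j * (real (card C) * sum w J)" by simp
  also have "\<dots> \<le> real j * (real (Suc j) * sum w C)"
    using le by (rule mult_left_mono) simp
  finally have "real (Suc j) * (real (card C) * sum w (J - {x})) \<le> real (Suc j) * (real j * sum w C)"
    by (simp add: mult.left_commute)
  then have "real (card C) * sum w (J - {x}) \<le> real j * sum w C"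
    by (rule mult_left_le_imp_le) simp
  moreover have "card (J - {x}) = j" using J(2) fin x by simp
  ultimately show ?case using J(1) by (intro exI[of _ "J - {x}"]) auto
qed

text \<open>If \<open>d\<close> were smaller than \<open>card J\<close>, recolouring the classes in
  \<open>J\<close> by \<open>h\<close> and keeping the other classes would use fewer than
  \<open>chromatic_number G\<close> colours. Properness of \<open>h\<close> is asked for only inside
  these classes, so \<open>h\<close> may come from a graph that sees only part of
  \<open>G\<close>.\<close>

lemma card_color_classes_le:
  assumes f: "proper_coloring G (chromatic_number G) f"
    and J: "J \<subseteq> {..<chromatic_number G}"
    and h: "\<And>v. v \<in> pverts G \<Longrightarrow> f v \<in> J \<Longrightarrow> h v < d"
    and h_proper: "\<And>u v. (u, v) \<in> parcs G \<Longrightarrow> f u \<in> J \<Longrightarrow> f v \<in> J \<Longrightarrow> h u \<noteq> h v"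
    and ends: "\<And>u v. (u, v) \<in> parcs G \<Longrightarrow> u \<in> pverts G \<and> v \<in> pverts G"
  shows "card J \<le> d"
proof -
  let ?c = "chromatic_number G"
  have card: "card ({..<?c} - J) = ?c - card J"
    using J by (simp add: card_Diff_subset finite_subset)
  obtain e where e: "bij_betw e ({..<?c} - J) {..<?c - card J}"
    using ex_bij_betw_finite_nat[of "{..<?c} - J"] card by (auto simp: lessThan_atLeast0)
  \<comment> \<open>\<open>e\<close> renumbers the surviving colours without gaps; the shift by
    \<open>d\<close> keeps them apart from the values of \<open>h\<close>.\<close>
  define g where "g v = (if f v \<in> J then h v else d + e (f v))" for v
  have f_less: "f v < ?c" if "v \<in> pverts G" for v
    using f that by (auto simp: proper_coloring_def)
  have e_less: "e (f v) < ?c - card J" if "v \<in> pverts G" "f v \<notin> J" for v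
    using bij_betwE[OF e] f_less[OF that(1)] that(2) by auto
  have "g v < d + (?c - card J)" if "v \<in> pverts G" for v
    using h[OF that] e_less[OF that] by (auto simp: g_def)
  moreover have "g u \<noteq> g v" if uv: "(u, v) \<in> parcs G" for u v
  proof -
    have "f u \<noteq> f v" using f uv by (auto simp: proper_coloring_def)
    then have "e (f u) \<noteq> e (f v)" if "f u \<notin> J" "f v \<notin> J"
      using e f_less ends[OF uv] that by (auto simp: bij_betw_def inj_on_def)
    moreover have "f u \<in> J \<Longrightarrow> h u < d" "f v \<in> J \<Longrightarrow> h v < d"
      using h ends[OF uv] by auto
    ultimately show ?thesis
      using h_proper[OF uv] by (auto simp: g_def)
  qed
  ultimately have "proper_coloring G (d + (?c - card J)) g"
    by (auto simp: proper_coloring_def)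
  then have "?c \<le> d + (?c - card J)"
    unfolding chromatic_number_def by (intro Least_le) blast
  \<comment> \<open>Ensures that the subtraction on naturals above does not truncate.\<close>
  moreover have "card J \<le> ?c" using card_mono[OF _ J] by simp
  ultimately show ?thesis by linarith
qed

lemma token_graph_insert_arc:
  assumes "(u, v) \<in> parcs G" "u \<noteq> v" "u \<in> pverts G" "v \<in> pverts G"
    and "u \<notin> S" "v \<notin> S" "S \<subseteq> pverts G" "finite S" "Suc (card S) = k"
  shows "(insert u S, insert v S) \<in> parcs (token_graph k G)"
proof -
  have "sym_diff (insert u S) (insert v S) = {u, v}" using assms by auto
  then show ?thesis using assms unfolding token_graph_simps by auto
qed

theorem theorem13:
  fixes G :: "'a pair_pre_digraph" and n k :: nat
  assumes "pair_graph G"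
    and "card (pverts G) = n"
    and "k \<ge> 1"
    and "n \<ge> k + 1"
  shows "real (chromatic_number (token_graph k G)) \<ge>
    (real n - real k + 2) / real n * real (chromatic_number G) - 1"
proof -
  interpret pair_graph G by (rule assms(1))
  define c where "c = chromatic_number G"
  define d where "d = chromatic_number (token_graph k G)"
  obtain f where f: "proper_coloring G (chromatic_number G) f"
    using chromatic_number_attained[OF assms(1)] by blast
  obtain g where g: "proper_coloring (token_graph k G) d g"
    using chromatic_number_attained[OF pair_graph_token_graph[OF assms(1)]] d_def by blast
  define W where "W J = {v \<in> pverts G. f v \<in> J}" for J
  note ends = in_arcsD1 in_arcsD2
  have W_large: "n - k + 2 \<le> card (W J)" if J: "J \<subseteq> {..<c}" and "d < card J" for J
  proof (rule ccontr)
    assume "\<not> ?thesis"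
    moreover have "card (pverts G - W J) = n - card (W J)"
      using assms(2) by (subst card_Diff_subset) (auto simp: W_def)
    \<comment> \<open>At most \<open>n - k + 1\<close> covered vertices leave at least
      \<open>k - 1\<close> free, just enough for \<open>S\<close>.\<close>
    ultimately have "k - 1 \<le> card (pverts G - W J)" using assms(3,4) by linarith
    then obtain S where S: "S \<subseteq> pverts G - W J" "card S = k - 1" "finite S"
      by (rule obtain_subset_with_card_n)
    \<comment> \<open>A vertex \<open>v\<close> of \<open>W J\<close> takes the colour of the token
      configuration that adds \<open>v\<close> to \<open>S\<close>.\<close>
    have "card J \<le> d"
    proof (rule card_color_classes_le[OF f, where h = "\<lambda>v. g (insert v S)"])
      show "J \<subseteq> {..<chromatic_number G}" using J c_def by simp
    next
      fix v assume "v \<in> pverts G" "f v \<in> J"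
      then have "insert v S \<in> pverts (token_graph k G)"
        using S assms(3) by (subst card_insert_disjoint token_graph_simps, auto simp: W_def)+
      then show "g (insert v S) < d" using g by (auto simp: proper_coloring_def)
    next
      fix u v assume uv: "(u, v) \<in> parcs G" "f u \<in> J" "f v \<in> J"
      have "(insert u S, insert v S) \<in> parcs (token_graph k G)"
        by (rule token_graph_insert_arc)
          (use uv S assms(3) ends[OF uv(1)] pair_no_loops[OF uv(1)] in \<open>auto simp: W_def\<close>)
      then show "g (insert u S) \<noteq> g (insert v S)"
        using g by (auto simp: proper_coloring_def)
    qed (use ends in blast)
    with \<open>d < card J\<close> show False by simp
  qed
  \<comment> \<open>The recolouring lemma with all classes at once and an injective
    \<open>h\<close>.\<close>
  have "c \<le> n"
  proof -
    obtain h where h: "bij_betw h (pverts G) {..<n}"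
      using ex_bij_betw_finite_nat[OF pair_finite_verts] assms(2) by (auto simp: lessThan_atLeast0)
    have "card {..<c} \<le> n"
    proof (rule card_color_classes_le[OF f, where h = h])
      fix u v assume uv: "(u, v) \<in> parcs G"
      show "h u \<noteq> h v"
        using h ends[OF uv] pair_no_loops[OF uv] by (auto simp: bij_betw_def inj_on_def)
    qed (use h ends c_def in \<open>auto simp: bij_betw_def\<close>)
    then show ?thesis by simp
  qed
  have n_pos: "real n > 0" using assms(4) by simp
  have "(real n - real k + 2) * real c \<le> (real d + 1) * real n"
  proof (cases "d < c")
    case True
    \<comment> \<open>Weighing each colour by the size of its class makes \<open>sum ?w J\<close>
      the number of vertices covered by \<open>J\<close>.\<close>
    let ?w = "\<lambda>i. real (card (W {i}))"
    have sum_w: "sum ?w J = card (W J)" if "J \<subseteq> {..<c}" for J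
    proof -
      have "card (W J) = card (\<Union>i\<in>J. W {i})"
        by (rule arg_cong[where f = card]) (auto simp: W_def)
      also have "\<dots> = (\<Sum>i\<in>J. card (W {i}))"
        by (rule card_UN_disjoint) (use that finite_subset in \<open>auto simp: W_def\<close>)
      finally show ?thesis by simp
    qed
    obtain J where J: "J \<subseteq> {..<c}" "card J = Suc d"
      and le: "real c * sum ?w J \<le> real (Suc d) * sum ?w {..<c}"
      using exists_subset_sum_le_average[of "{..<c}" "Suc d" ?w] True by auto
    have "W {..<c} = pverts G" using f by (auto simp: W_def c_def proper_coloring_def)
    then have "real c * card (W J) \<le> (real d + 1) * real n"
      using le sum_w J(1) assms(2) by (simp add: algebra_simps)
    moreover have "real n - real k + 2 \<le> card (W J)"
      using W_large[of J] J assms(4) by linarith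
    then have "real c * (real n - real k + 2) \<le> real c * card (W J)"
      by (rule mult_left_mono) simp
    ultimately show ?thesis by (simp add: mult.commute)
  next
    \<comment> \<open>There are no \<open>d + 1\<close> classes to choose here, but the bound
      already holds with \<open>c\<close> in place of \<open>d\<close>, by \<open>1 \<le> k\<close>
      and \<open>c \<le> n\<close>.\<close>
    case False
    have "(real n - real k + 2) * real c \<le> (real n + 1) * real c"
      using assms(3) by (intro mult_right_mono) auto
    also have "\<dots> \<le> (real c + 1) * real n" using \<open>c \<le> n\<close> by (simp add: algebra_simps)
    also have "\<dots> \<le> (real d + 1) * real n" using False by (intro mult_right_mono) auto
    finally show ?thesis .
  qed
  then have "(real n - real k + 2) / real n * real c \<le> real d + 1"
    using n_pos by (simp add: field_simps)
  then show ?thesis by (simp add: c_def d_def)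
qed

end
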